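(* Let $(W,S)$ be a Coxeter system, $\mathbb{F}$ a field, and $\mathbf{q}=(q_s\in\mathbb{F}: s\in S)$. Suppose there exist $s,t\in S$ with $m_{st}$ odd such that $q_s$ and $q_t$ are distinct and both nonzero. Let $R$ be the set of all elements $r\in S$ (including $s$ itself) that are connected to $s$ by some path in the Coxeter diagram of $(W,S)$ all of whose edges have odd weights and all of whose vertices $v$ satisfy $q_v\neq 0$. Then $\mathcal{H}_S(\mathbf{q})\cong\mathcal{H}_{S\setminus R}(\mathbf{q})$ as $\mathbb{F}$-algebras.
   Context: A Coxeter system $(W,S)$ has $S$ finite and $W=\langle S: s^2=1,\ (sts\cdots)_{m_{st}}=(tst\cdots)_{m_{st}}\ \forall s\ne t\in S\rangle$, where $m_{st}=m_{ts}\in\{2,3,\ldots\}\cup\{\infty\}$ and $(aba\cdots)_m$ denotes the alternating product of $m$ factors starting with $a$; no relation is imposed between $s$ and $t$ if $m_{st}=\infty$ (and $\infty$ is not odd). The Coxeter diagram is the edge-weighted graph with vertex set $S$ and an edge of weight $m_{st}$ between $s\neq t$ whenever $m_{st}\ge 3$. The Hecke algebra $\mathcal{H}(\mathbf{q})=\mathcal{H}_S(\mathbf{q})$ of $(W,S)$ with independent parameters $\mathbf{q}=(q_s\in\mathbb{F}:s\in S)$ is the unital associative $\mathbb{F}$-algebra generated by $\{T_s:s\in S\}$ subject to the quadratic relations $(T_s-1)(T_s+q_s)=0$ for all $s\in S$ and the braid relations $(T_sT_tT_s\cdots)_{m_{st}}=(T_tT_sT_t\cdots)_{m_{st}}$ for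 all $s\neq t$ in $S$ (none if $m_{st}=\infty$). For a subset $I\subseteq S$, $W_I:=\langle I\rangle$, and $\mathcal{H}_I(\mathbf{q})$ denotes the Hecke algebra of the Coxeter system $(W_I,I)$ with independent parameters $(q_s:s\in I)$ (so $\mathcal{H}_\emptyset(\mathbf{q})=\mathbb{F}$). *)

theory Defs
  imports
    "HOL-Algebra.Generated_Groups"
    "HOL-Algebra.Module"
    "HOL-Algebra.QuotRing"
    "HOL-Library.Extended_Nat"
    "HOL-Library.Poly_Mapping"
begin

section \<open>Coxeter systems\<close>

fun alternating :: "'a \<Rightarrow> 'a \<Rightarrow> nat \<Rightarrow> 'a list" where
  "alternating a b 0 = []"
| "alternating a b (Suc n) = a # alternating b a n"

text \<open>
  The congruence on words over \<open>S\<close> generated by the Coxeter relations. Since the generators are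
  involutions, every element of the presented group is represented by a word without formal
  inverses, so the quotient of the free monoid by this congruence is the presented group.
\<close>

inductive coxeter_congruence :: "'a set \<Rightarrow> ('a \<Rightarrow> 'a \<Rightarrow> enat) \<Rightarrow> 'a list \<Rightarrow> 'a list \<Rightarrow> bool"
  for S m where
  refl: "coxeter_congruence S m w w"
| sym: "coxeter_congruence S m v w \<Longrightarrow> coxeter_congruence S m w v"
| trans: "coxeter_congruence S m u v \<Longrightarrow> coxeter_congruence S m v w \<Longrightarrow> coxeter_congruence S m u w"
| square: "s \<in> S \<Longrightarrow> coxeter_congruence S m (u @ [s, s] @ v) (u @ v)"
| braid: "s \<in> S \<Longrightarrow> t \<in> S \<Longrightarrow> s \<noteq> t \<Longrightarrow> m s t = enat n \<Longrightarrow>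
    coxeter_congruence S m (u @ alternating s t n @ v) (u @ alternating t s n @ v)"

definition word_value :: "('w, 'b) monoid_scheme \<Rightarrow> 'w list \<Rightarrow> 'w" where
  "word_value W w = foldr (\<otimes>\<^bsub>W\<^esub>) w \<one>\<^bsub>W\<^esub>"

text \<open>
  The value of \<open>m\<close> on the diagonal and outside \<open>S\<close> is irrelevant. The last two assumptions say that
  \<open>W\<close> is the group presented by the generators \<open>S\<close> and the Coxeter relations.
\<close>

locale coxeter_system = group W
  for W :: "('w, 'b) monoid_scheme" (structure) and S :: "'w set" and m :: "'w \<Rightarrow> 'w \<Rightarrow> enat" +
  assumes finite_S: "finite S"
    and S_carrier: "S \<subseteq> carrier W"
    and m_sym: "\<lbrakk>s \<in> S; t \<in> S; s \<noteq> t\<rbrakk> \<Longrightarrow> m s t = m t s"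
    and m_ge_2: "\<lbrakk>s \<in> S; t \<in> S; s \<noteq> t\<rbrakk> \<Longrightarrow> m s t \<ge> 2"
    and generated: "generate W S = carrier W"
    and presented: "\<lbrakk>v \<in> lists S; w \<in> lists S\<rbrakk> \<Longrightarrow>
      word_value W v = word_value W w \<longleftrightarrow> coxeter_congruence S m v w"

definition odd_weight :: "enat \<Rightarrow> bool" where
  "odd_weight k \<longleftrightarrow> (\<exists>n. k = enat n \<and> odd n)"

definition diagram_edge :: "'a set \<Rightarrow> ('a \<Rightarrow> 'a \<Rightarrow> enat) \<Rightarrow> 'a \<Rightarrow> 'a \<Rightarrow> bool" where
  "diagram_edge S m a b \<longleftrightarrow> a \<in> S \<and> b \<in> S \<and> a \<noteq> b \<and> m a b \<ge> 3"

text \<open>A path is given by the list of its vertices; a single vertex is a path without edges.\<close>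

definition diagram_path :: "'a set \<Rightarrow> ('a \<Rightarrow> 'a \<Rightarrow> enat) \<Rightarrow> 'a \<Rightarrow> 'a list \<Rightarrow> 'a \<Rightarrow> bool" where
  "diagram_path S m a p b \<longleftrightarrow>
     p \<noteq> [] \<and> hd p = a \<and> last p = b \<and> set p \<subseteq> S \<and> distinct p \<and> successively (diagram_edge S m) p"

definition odd_nonzero_component ::
  "'a set \<Rightarrow> ('a \<Rightarrow> 'a \<Rightarrow> enat) \<Rightarrow> ('a \<Rightarrow> 'k::zero) \<Rightarrow> 'a \<Rightarrow> 'a set" where
  "odd_nonzero_component S m q s =
     {r \<in> S. \<exists>p. diagram_path S m s p r \<and>
        successively (\<lambda>a b. odd_weight (m a b)) p \<and> (\<forall>v\<in>set p. q v \<noteq> 0)}"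

section \<open>Algebras over a field\<close>

text \<open>
  The record type \<^type>\<open>module_ext\<close> is used for associative, not necessarily commutative algebras
  over a type of class \<^class>\<open>field\<close>.
\<close>

definition algebra_iso :: "('k, 'a) module \<Rightarrow> ('k, 'b) module \<Rightarrow> ('a \<Rightarrow> 'b) set" where
  "algebra_iso A B =
     {h \<in> ring_iso A B. \<forall>c. \<forall>x\<in>carrier A. h (c \<odot>\<^bsub>A\<^esub> x) = c \<odot>\<^bsub>B\<^esub> h x}"

definition is_algebra_iso :: "('k, 'a) module \<Rightarrow> ('k, 'b) module \<Rightarrow> bool"
    (infixr \<open>\<simeq>\<^sub>a\<close> 60) where
  "A \<simeq>\<^sub>a B \<longleftrightarrow> algebra_iso A B \<noteq> {}"

text \<open>The scalar multiplication on cosets follows the pattern of \<^const>\<open>rcoset_mult\<close>.\<close>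

definition quotient_algebra :: "('k, 'a) module \<Rightarrow> 'a set \<Rightarrow> ('k, 'a set) module" where
  "quotient_algebra A J =
     ring.extend (A Quot J) (module.fields (\<lambda>c X. \<Union>x\<in>X. J +>\<^bsub>A\<^esub> (c \<odot>\<^bsub>A\<^esub> x)))"

section \<open>The free algebra\<close>

datatype 'a free_word = Word (letters: "'a list")

instantiation free_word :: (type) monoid_add
begin

definition "0 = Word []"
definition "u + v = Word (letters u @ letters v)"

instance
  by standard (simp_all add: zero_free_word_def plus_free_word_def)

end

text \<open>
  The free unital associative algebra on a set \<open>I\<close> of generators is the monoid algebra of the free
  monoid on \<open>I\<close>. The ring structure of \<^type>\<open>poly_mapping\<close> is the convolution product, so it
  restricts to the functions supported on words over \<open>I\<close>.
\<close>

definition free_algebra :: "'a set \<Rightarrow> ('k::field, 'a free_word \<Rightarrow>\<^sub>0 'k) module" where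
  "free_algebra I =
     \<lparr>carrier = {f. \<forall>w\<in>Poly_Mapping.keys f. letters w \<in> lists I},
      monoid.mult = (*), one = 1, zero = 0, add = (+),
      smult = (\<lambda>c f. Poly_Mapping.single 0 c * f)\<rparr>"

definition free_gen :: "'a \<Rightarrow> ('a free_word \<Rightarrow>\<^sub>0 'k::field)" where
  "free_gen a = Poly_Mapping.single (Word [a]) 1"

lemma ring_free_algebra:
  fixes I :: "'a set"
  shows "ring (free_algebra I :: ('k::field, 'a free_word \<Rightarrow>\<^sub>0 'k) module)"
proof -
  define C where "C = {f :: 'a free_word \<Rightarrow>\<^sub>0 'k. \<forall>w\<in>Poly_Mapping.keys f. letters w \<in> lists I}"
  have add: "f + g \<in> C" if "f \<in> C" "g \<in> C" for f g
    using that Poly_Mapping.keys_add[of f g] unfolding C_def by blast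
  have mult: "f * g \<in> C" if "f \<in> C" "g \<in> C" for f g
    using that keys_mult[of f g] unfolding C_def by (fastforce simp: plus_free_word_def)
  have minus: "- f \<in> C" if "f \<in> C" for f
    using that by (auto simp: C_def in_keys_iff)
  have zero: "0 \<in> C" and one: "1 \<in> C"
    by (simp_all add: C_def zero_free_word_def)
  have A: "free_algebra I = \<lparr>carrier = C, monoid.mult = (*), one = 1, zero = 0, add = (+),
      smult = (\<lambda>c f. Poly_Mapping.single 0 c * f)\<rparr>"
    by (simp add: free_algebra_def C_def)
  show ?thesis
    unfolding A
    by (intro ringI abelian_groupI monoidI)
      (auto simp: add.assoc add.commute mult.assoc distrib_left distrib_right
        intro: add mult zero one intro!: bexI[OF _ minus])
qed

section \<open>Hecke algebras with independent parameters\<close>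

text \<open>
  In \<open>hecke_relators I m q\<close> and \<open>hecke_algebra I m q\<close> only the restrictions of \<open>m\<close> and \<open>q\<close> to \<open>I\<close>
  matter. For a Coxeter system \<open>(W, S)\<close> with matrix \<open>m\<close> and \<open>I \<subseteq> S\<close>, the Coxeter system \<open>(W\<^sub>I, I)\<close>
  has as matrix the restriction of \<open>m\<close>, so its Hecke algebra is \<open>hecke_algebra I m q\<close>.
\<close>

definition hecke_relators ::
  "'a set \<Rightarrow> ('a \<Rightarrow> 'a \<Rightarrow> enat) \<Rightarrow> ('a \<Rightarrow> 'k::field) \<Rightarrow> ('a free_word \<Rightarrow>\<^sub>0 'k) set" where
  "hecke_relators I m q =
     {(free_gen s - 1) * (free_gen s + Poly_Mapping.single 0 (q s)) | s. s \<in> I} \<union>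
     {prod_list (map free_gen (alternating s t n)) - prod_list (map free_gen (alternating t s n))
        | s t n. s \<in> I \<and> t \<in> I \<and> s \<noteq> t \<and> m s t = enat n}"

definition hecke_algebra ::
  "'a set \<Rightarrow> ('a \<Rightarrow> 'a \<Rightarrow> enat) \<Rightarrow> ('a \<Rightarrow> 'k::field) \<Rightarrow> ('k, ('a free_word \<Rightarrow>\<^sub>0 'k) set) module" where
  "hecke_algebra I m q =
     quotient_algebra (free_algebra I) (Idl\<^bsub>free_algebra I\<^esub> (hecke_relators I m q))"

lemma smult_quotient_algebra_free:
  fixes I :: "'a set" and c :: "'k::field"
  assumes "ideal J (free_algebra I)" and "f \<in> carrier (free_algebra I)"
  shows "c \<odot>\<^bsub>quotient_algebra (free_algebra I) J\<^esub> (J +>\<^bsub>free_algebra I\<^esub> f) =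
    J +>\<^bsub>free_algebra I\<^esub> (c \<odot>\<^bsub>free_algebra I\<^esub> f)"
proof -
  let ?A = "free_algebra I :: ('k, 'a free_word \<Rightarrow>\<^sub>0 'k) module"
  interpret ideal J ?A by fact
  have C: "Poly_Mapping.single 0 c \<in> carrier ?A"
    by (simp add: free_algebra_def zero_free_word_def)
  have sm: "c \<odot>\<^bsub>?A\<^esub> x = Poly_Mapping.single 0 c \<otimes>\<^bsub>?A\<^esub> x" for x
    by (simp add: free_algebra_def)
  have cos: "J +>\<^bsub>?A\<^esub> (Poly_Mapping.single 0 c \<otimes>\<^bsub>?A\<^esub> x) =
      J +>\<^bsub>?A\<^esub> (Poly_Mapping.single 0 c \<otimes>\<^bsub>?A\<^esub> f)" if "x \<in> J +>\<^bsub>?A\<^esub> f" for x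
  proof -
    have x: "x \<in> carrier ?A"
      using that a_r_coset_subset_G[OF a_subset assms(2)] by blast
    have "J +>\<^bsub>?A\<^esub> x = J +>\<^bsub>?A\<^esub> f"
      using a_repr_independence[OF that assms(2) a_subgroup] by simp
    then show ?thesis
      using rcoset_mult_add[OF C x] rcoset_mult_add[OF C assms(2)] by simp
  qed
  have "f \<in> J +>\<^bsub>?A\<^esub> f"
    using a_rcos_self[OF assms(2)] by simp
  then have "(\<Union>x\<in>J +>\<^bsub>?A\<^esub> f. J +>\<^bsub>?A\<^esub> (c \<odot>\<^bsub>?A\<^esub> x)) = J +>\<^bsub>?A\<^esub> (c \<odot>\<^bsub>?A\<^esub> f)"
    unfolding sm using cos by blast
  then show ?thesis
    by (simp add: quotient_algebra_def ring.defs module.defs)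
qed

lemma ring_quotient_algebra:
  assumes "ring A" and "ideal J A"
  shows "ring (quotient_algebra A J)"
proof -
  interpret Q: ring "A Quot J"
    using assms(2) by (rule ideal.quotient_is_ring)
  have "id \<in> ring_iso (A Quot J) (quotient_algebra A J)"
    by (auto simp: ring_iso_def ring_hom_def quotient_algebra_def ring.defs)
  then have "ring ((quotient_algebra A J) \<lparr>zero := id \<zero>\<^bsub>A Quot J\<^esub>\<rparr>)"
    by (rule Q.ring_iso_imp_img_ring)
  then show ?thesis
    by (simp add: quotient_algebra_def ring.defs)
qed

lemma hecke_relators_subset:
  fixes q :: "'a \<Rightarrow> 'k::field"
  shows "hecke_relators I m q \<subseteq> carrier (free_algebra I)"
proof -
  interpret ring "free_algebra I :: ('k, 'a free_word \<Rightarrow>\<^sub>0 'k) module"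
    by (rule ring_free_algebra)
  let ?C = "carrier (free_algebra I :: ('k, 'a free_word \<Rightarrow>\<^sub>0 'k) module)"
  have mult: "f * g \<in> ?C" and add: "f + g \<in> ?C" if "f \<in> ?C" "g \<in> ?C" for f g
    using m_closed[OF that] a_closed[OF that] by (simp_all add: free_algebra_def)
  have minus: "f - g \<in> ?C" if "f \<in> ?C" "g \<in> ?C" for f g
  proof -
    have "- g \<in> ?C"
      using that by (auto simp: free_algebra_def in_keys_iff)
    then show ?thesis
      using add[OF that(1)] by fastforce
  qed
  have const: "Poly_Mapping.single 0 c \<in> ?C" for c
    by (simp add: free_algebra_def zero_free_word_def)
  have one: "1 \<in> ?C"
    using const[of 1] by simp
  have gen: "free_gen s \<in> ?C" if "s \<in> I" for s
    using that by (simp add: free_algebra_def free_gen_def)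
  have alt: "prod_list (map free_gen (alternating s t n)) \<in> ?C" if "s \<in> I" "t \<in> I" for s t n
    using that by (induction n arbitrary: s t) (auto intro: one mult gen)
  show ?thesis
    unfolding hecke_relators_def by (auto intro!: mult add minus one const gen alt)
qed

lemma ring_hecke_algebra: "ring (hecke_algebra I m q)"
  unfolding hecke_algebra_def
  by (intro ring_quotient_algebra ring_free_algebra ring.genideal_ideal hecke_relators_subset)

end

theory Submission
  imports Defs
begin

text \<open>
  Since \<open>m s t\<close> is odd, \<open>T\<^sub>s\<close> and \<open>T\<^sub>t\<close> are conjugate by a unit, so \<open>T\<^sub>s\<close> is a root of both
  \<open>(x - 1) (x + q\<^sub>s)\<close> and \<open>(x - 1) (x + q\<^sub>t)\<close>, which forces \<open>T\<^sub>s = 1\<close>. If \<open>T\<^sub>a = 1\<close>, an odd braid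
  relation between \<open>a\<close> and \<open>b\<close> reads \<open>T\<^sub>b\<^sup>k = T\<^sub>b\<^sup>k\<^sup>+\<^sup>1\<close>, hence \<open>T\<^sub>b = 1\<close> when \<open>q\<^sub>b \<noteq> 0\<close>; so all
  generators in \<open>R\<close> are trivial. Conversely, putting \<open>T\<^sub>r = 1\<close> for \<open>r \<in> R\<close> imposes nothing on the
  other generators: a braid relation between \<open>r \<in> R\<close> and \<open>u \<notin> R\<close> becomes trivial if \<open>m r u\<close> is
  even, and if it is odd then \<open>q\<^sub>u = 0\<close> by the definition of \<open>R\<close>, so \<open>T\<^sub>u\<close> is already idempotent.
  Deleting the letters of \<open>R\<close> from words therefore induces the isomorphism.
\<close>

section \<open>Finitely supported functions\<close>

text \<open>A finitely supported function is the sum of its singletons. The case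
  \<open>single\<close> is restricted to keys of \<open>f\<close>, so that a support condition on
  \<open>f\<close>, such as being supported on words over \<open>I\<close>, is available
  there.\<close>

lemma poly_mapping_single_induct [case_names zero add single]:
  fixes f :: "'a \<Rightarrow>\<^sub>0 'b::comm_monoid_add"
  assumes "P 0" and "\<And>f g. P f \<Longrightarrow> P g \<Longrightarrow> P (f + g)"
    and "\<And>k c. k \<in> Poly_Mapping.keys f \<Longrightarrow> P (Poly_Mapping.single k c)"
  shows "P f"
proof -
  have "P (\<Sum>k\<in>A. Poly_Mapping.single k (Poly_Mapping.lookup f k))"
    if "A \<subseteq> Poly_Mapping.keys f" for A
    using finite_subset[OF that finite_keys] that
    by (induction A rule: finite_induct) (auto intro: assms)
  moreover have "(\<Sum>k\<in>Poly_Mapping.keys f. Poly_Mapping.single k (Poly_Mapping.lookup f k)) = f"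
    by (rule poly_mapping_eqI)
      (auto simp: lookup_sum lookup_single when_def sum.delta' in_keys_iff)
  ultimately show ?thesis
    by (metis order_refl)
qed

text \<open>Scalars are embedded as constants at the neutral element; their centrality lets the
  parameters \<open>q s\<close> move past generators in the identities for Hecke relations.\<close>

lemma single_0_commute:
  fixes f :: "'a::monoid_add \<Rightarrow>\<^sub>0 'k::comm_semiring_0"
  shows "Poly_Mapping.single 0 c * f = f * Poly_Mapping.single 0 c"
  by (induction f rule: poly_mapping_single_induct)
    (simp_all add: distrib_left distrib_right mult_single mult.commute)

text \<open>The additive extension of \<open>g\<close> from basis elements; for a monoid
  homomorphism \<open>g\<close> it is the induced map of monoid algebras.\<close>

definition pushforward :: "('a \<Rightarrow> 'b) \<Rightarrow> ('a \<Rightarrow>\<^sub>0 'k) \<Rightarrow> ('b \<Rightarrow>\<^sub>0 'k::comm_monoid_add)" where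
  "pushforward g f = (\<Sum>k\<in>Poly_Mapping.keys f. Poly_Mapping.single (g k) (Poly_Mapping.lookup f k))"

lemma pushforward_zero [simp]: "pushforward g 0 = 0"
  by (simp add: pushforward_def)

lemma pushforward_single [simp]:
  "pushforward g (Poly_Mapping.single k c) = Poly_Mapping.single (g k) c"
  by (simp add: pushforward_def)

lemma pushforward_add: "pushforward g (f + f') = pushforward g f + pushforward g f'"
  unfolding pushforward_def
  by (rule setsum_keys_plus_distrib) (simp_all add: single_add)

lemma pushforward_diff:
  fixes f :: "'a \<Rightarrow>\<^sub>0 'k::ab_group_add"
  shows "pushforward g (f - f') = pushforward g f - pushforward g f'"
  using pushforward_add[of g "f - f'" f'] by simp

text \<open>Both sides are additive in each factor, which reduces the claim to singletons, where it
  is the hypothesis on \<open>g\<close>.\<close>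

lemma pushforward_mult:
  fixes f :: "'a::monoid_add \<Rightarrow>\<^sub>0 'k::semiring_0" and g :: "'a \<Rightarrow> 'b::monoid_add"
  assumes g: "\<And>k l. g (k + l) = g k + g l"
  shows "pushforward g (f * f') = pushforward g f * pushforward g f'"
proof (induction f rule: poly_mapping_single_induct)
  case (single k c)
  show ?case
    by (induction f' rule: poly_mapping_single_induct)
      (simp_all add: pushforward_add distrib_left mult_single g)
qed (simp_all add: pushforward_add distrib_right)

lemma pushforward_cong:
  "(\<And>k. k \<in> Poly_Mapping.keys f \<Longrightarrow> g k = g' k) \<Longrightarrow> pushforward g f = pushforward g' f"
  by (simp add: pushforward_def)

lemma pushforward_id [simp]: "pushforward (\<lambda>k. k) f = f"
  by (induction f rule: poly_mapping_single_induct) (simp_all add: pushforward_add)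

lemma keys_pushforward: "Poly_Mapping.keys (pushforward g f) \<subseteq> g ` Poly_Mapping.keys f"
proof -
  have "Poly_Mapping.keys (pushforward g f) \<subseteq>
      (\<Union>k\<in>Poly_Mapping.keys f. Poly_Mapping.keys (Poly_Mapping.single (g k) (Poly_Mapping.lookup f k)))"
    unfolding pushforward_def by (rule Poly_Mapping.keys_sum)
  then show ?thesis
    by (auto split: if_splits)
qed

section \<open>The free algebra\<close>

lemma free_algebra_simps [simp]:
  "x \<otimes>\<^bsub>free_algebra I\<^esub> y = x * y" "x \<oplus>\<^bsub>free_algebra I\<^esub> y = x + y"
  "\<one>\<^bsub>free_algebra I\<^esub> = 1" "\<zero>\<^bsub>free_algebra I\<^esub> = 0"
  "c \<odot>\<^bsub>free_algebra I\<^esub> x = Poly_Mapping.single 0 c * x"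
  by (simp_all add: free_algebra_def)

lemma free_algebra_carrier:
  "f \<in> carrier (free_algebra I) \<longleftrightarrow> (\<forall>w\<in>Poly_Mapping.keys f. letters w \<in> lists I)"
  by (simp add: free_algebra_def)

lemma free_algebra_carrier_intros [intro]:
  fixes x y :: "'a free_word \<Rightarrow>\<^sub>0 'k::field" and c :: 'k
  shows "(1 :: 'a free_word \<Rightarrow>\<^sub>0 'k) \<in> carrier (free_algebra I)"
    and "Poly_Mapping.single 0 c \<in> carrier (free_algebra I)"
    and "s \<in> I \<Longrightarrow> (free_gen s :: 'a free_word \<Rightarrow>\<^sub>0 'k) \<in> carrier (free_algebra I)"
    and "set v \<subseteq> I \<Longrightarrow> Poly_Mapping.single (Word v) c \<in> carrier (free_algebra I)"
    and "x \<in> carrier (free_algebra I) \<Longrightarrow> y \<in> carrier (free_algebra I) \<Longrightarrow> x * y \<in> carrier (free_algebra I)"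
    and "x \<in> carrier (free_algebra I) \<Longrightarrow> y \<in> carrier (free_algebra I) \<Longrightarrow> x + y \<in> carrier (free_algebra I)"
    and "x \<in> carrier (free_algebra I) \<Longrightarrow> y \<in> carrier (free_algebra I) \<Longrightarrow> x - y \<in> carrier (free_algebra I)"
    and "x \<in> carrier (free_algebra I) \<Longrightarrow> - x \<in> carrier (free_algebra I)"
proof -
  interpret ring "free_algebra I :: ('k, 'a free_word \<Rightarrow>\<^sub>0 'k) module"
    by (rule ring_free_algebra)
  show "(1 :: 'a free_word \<Rightarrow>\<^sub>0 'k) \<in> carrier (free_algebra I)"
    using one_closed by simp
  show "Poly_Mapping.single 0 c \<in> carrier (free_algebra I)" for c :: 'k
    by (simp add: free_algebra_carrier zero_free_word_def)
  show "(free_gen s :: 'a free_word \<Rightarrow>\<^sub>0 'k) \<in> carrier (free_algebra I)" if "s \<in> I"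
    using that by (simp add: free_algebra_carrier free_gen_def)
  show "Poly_Mapping.single (Word v) c \<in> carrier (free_algebra I)" if "set v \<subseteq> I" for c :: 'k
    using that by (auto simp: free_algebra_carrier)
  show minus: "- x \<in> carrier (free_algebra I)" if "x \<in> carrier (free_algebra I)" for x :: "'a free_word \<Rightarrow>\<^sub>0 'k"
    using that by (simp add: free_algebra_carrier in_keys_iff)
  show "x * y \<in> carrier (free_algebra I)"
    if "x \<in> carrier (free_algebra I)" "y \<in> carrier (free_algebra I)" for x y :: "'a free_word \<Rightarrow>\<^sub>0 'k"
    using m_closed[OF that] by simp
  show add: "x + y \<in> carrier (free_algebra I)"
    if "x \<in> carrier (free_algebra I)" "y \<in> carrier (free_algebra I)" for x y :: "'a free_word \<Rightarrow>\<^sub>0 'k"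
    using a_closed[OF that] by simp
  show "x - y \<in> carrier (free_algebra I)"
    if "x \<in> carrier (free_algebra I)" "y \<in> carrier (free_algebra I)" for x y :: "'a free_word \<Rightarrow>\<^sub>0 'k"
    using add[OF that(1) minus[OF that(2)]] by simp
qed

lemma free_algebra_mono: "I' \<subseteq> I \<Longrightarrow> carrier (free_algebra I') \<subseteq> carrier (free_algebra I)"
  by (fastforce simp: free_algebra_carrier)

lemma free_algebra_minus [simp]:
  fixes x :: "'a free_word \<Rightarrow>\<^sub>0 'k::field"
  assumes "x \<in> carrier (free_algebra I)"
  shows "\<ominus>\<^bsub>free_algebra I\<^esub> x = - x"
proof -
  interpret ring "free_algebra I :: ('k, 'a free_word \<Rightarrow>\<^sub>0 'k) module"
    by (rule ring_free_algebra)
  show ?thesis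
    using assms by (intro minus_equality) auto
qed

text \<open>Ideal closure in terms of \<open>+\<close>, \<open>-\<close> and \<open>*\<close> of the
  type, so that membership combines with identities proved by \<open>algebra_simps\<close>.\<close>

lemma free_algebra_ideal:
  assumes "ideal J (free_algebra I)"
  shows "J \<subseteq> carrier (free_algebra I)"
    and "0 \<in> J"
    and "x \<in> J \<Longrightarrow> y \<in> J \<Longrightarrow> x + y \<in> J"
    and "x \<in> J \<Longrightarrow> y \<in> J \<Longrightarrow> x - y \<in> J"
    and "x \<in> J \<Longrightarrow> a \<in> carrier (free_algebra I) \<Longrightarrow> a * x \<in> J"
    and "x \<in> J \<Longrightarrow> a \<in> carrier (free_algebra I) \<Longrightarrow> x * a \<in> J"
proof -
  have sub: "additive_subgroup J (free_algebra I)"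
    using assms by (rule ideal.axioms(1))
  show J: "J \<subseteq> carrier (free_algebra I)"
    using sub by (rule additive_subgroup.a_subset)
  show "0 \<in> J"
    using additive_subgroup.zero_closed[OF sub] by simp
  show add: "x + y \<in> J" if "x \<in> J" "y \<in> J" for x y
    using additive_subgroup.a_closed[OF sub that] by simp
  have minus: "- y \<in> J" if "y \<in> J" for y
    using additive_subgroup.a_inv_closed[OF sub that] J that by (simp add: subset_iff)
  show "x - y \<in> J" if "x \<in> J" "y \<in> J" for x y
    using add[OF that(1) minus[OF that(2)]] by simp
  show "a * x \<in> J" "x * a \<in> J" if "x \<in> J" "a \<in> carrier (free_algebra I)"
    using ideal.I_l_closed[OF assms that] ideal.I_r_closed[OF assms that] by simp_all
qed

lemma free_algebra_ideal_coset:
  assumes "ideal J (free_algebra I)" "x \<in> carrier (free_algebra I)" "y \<in> carrier (free_algebra I)"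
  shows "J +>\<^bsub>free_algebra I\<^esub> x = J +>\<^bsub>free_algebra I\<^esub> y \<longleftrightarrow> x - y \<in> J"
  using ring.quotient_eq_iff_same_a_r_cos[OF ring_free_algebra assms] assms(3)
  by (simp add: a_minus_def)

lemma prod_list_free_gen: "prod_list (map free_gen v) = Poly_Mapping.single (Word v) 1"
  by (induction v)
    (simp_all add: free_gen_def mult_single plus_free_word_def flip: zero_free_word_def)

lemma single_Word_Cons:
  "Poly_Mapping.single (Word (a # v)) 1 = free_gen a * Poly_Mapping.single (Word v) 1"
  by (simp add: free_gen_def mult_single plus_free_word_def)

lemma single_Word_snoc:
  "Poly_Mapping.single (Word (v @ [a])) 1 = Poly_Mapping.single (Word v) 1 * free_gen a"
  by (simp add: free_gen_def mult_single plus_free_word_def)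

section \<open>Deleting generators\<close>

text \<open>The algebra homomorphism that sends the generators in \<open>R\<close> to 1 and fixes
  the others. Since the empty word is the unit, this amounts to erasing letters.\<close>

definition delete_gens :: "'a set \<Rightarrow> ('a free_word \<Rightarrow>\<^sub>0 'k) \<Rightarrow> ('a free_word \<Rightarrow>\<^sub>0 'k::field)" where
  "delete_gens R = pushforward (\<lambda>w. Word (filter (\<lambda>a. a \<notin> R) (letters w)))"

lemma delete_gens_simps [simp]:
  fixes f g :: "'a free_word \<Rightarrow>\<^sub>0 'k::field" and c :: 'k
  shows "delete_gens R (f + g) = delete_gens R f + delete_gens R g"
    and "delete_gens R (f - g) = delete_gens R f - delete_gens R g"
    and "delete_gens R (f * g) = delete_gens R f * delete_gens R g"
    and "delete_gens R (Poly_Mapping.single w c) =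
      Poly_Mapping.single (Word (filter (\<lambda>a. a \<notin> R) (letters w))) c"
    and "delete_gens R (1 :: 'a free_word \<Rightarrow>\<^sub>0 'k) = 1"
    and "delete_gens R (free_gen a :: 'a free_word \<Rightarrow>\<^sub>0 'k) = (if a \<in> R then 1 else free_gen a)"
proof -
  show *: "delete_gens R (Poly_Mapping.single w c) =
      Poly_Mapping.single (Word (filter (\<lambda>a. a \<notin> R) (letters w))) c" for w :: "'a free_word" and c :: 'k
    by (simp add: delete_gens_def)
  show "delete_gens R (1 :: 'a free_word \<Rightarrow>\<^sub>0 'k) = 1"
    using *[of "Word []" 1] by (simp flip: single_one add: zero_free_word_def)
  show "delete_gens R (free_gen a :: 'a free_word \<Rightarrow>\<^sub>0 'k) = (if a \<in> R then 1 else free_gen a)"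
    by (simp add: free_gen_def * flip: zero_free_word_def)
qed (simp_all add: delete_gens_def pushforward_add pushforward_diff pushforward_mult plus_free_word_def)

lemma delete_gens_const [simp]:
  "delete_gens R (Poly_Mapping.single 0 c) = Poly_Mapping.single 0 c"
  by (simp add: zero_free_word_def)

lemma delete_gens_carrier:
  "f \<in> carrier (free_algebra I) \<Longrightarrow> delete_gens R f \<in> carrier (free_algebra (I - R))"
  using keys_pushforward[of "\<lambda>w. Word (filter (\<lambda>a. a \<notin> R) (letters w))" f]
  by (fastforce simp: free_algebra_carrier delete_gens_def)

lemma delete_gens_id:
  assumes "f \<in> carrier (free_algebra (I - R))"
  shows "delete_gens R f = f"
proof -
  have "delete_gens R f = pushforward (\<lambda>w. w) f"
    unfolding delete_gens_def
    using assms by (intro pushforward_cong) (force simp: free_algebra_carrier free_word.expand filter_id_conv)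
  then show ?thesis
    by simp
qed

text \<open>Modulo \<open>J\<close> every generator in \<open>R\<close> equals 1, so erasing such
  letters from a word does not change its class; linearity extends this from words to
  \<open>f\<close>.\<close>

lemma diff_delete_gens_in_ideal:
  fixes f :: "'a free_word \<Rightarrow>\<^sub>0 'k::field"
  assumes J: "ideal J (free_algebra I)"
    and R: "\<And>r. r \<in> R \<Longrightarrow> r \<in> I \<Longrightarrow> free_gen r - 1 \<in> J"
    and f: "f \<in> carrier (free_algebra I)"
  shows "f - delete_gens R f \<in> J"
proof -
  note J_closed = free_algebra_ideal[OF J]
  have word: "Poly_Mapping.single (Word v) 1 - delete_gens R (Poly_Mapping.single (Word v) 1) \<in> J"
    if "set v \<subseteq> I" for v
    using that
  proof (induction v)
    case (Cons a v)
    let ?x = "Poly_Mapping.single (Word v) 1 :: 'a free_word \<Rightarrow>\<^sub>0 'k"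
    have "?x - delete_gens R ?x \<in> J"
      using Cons by simp
    then have "free_gen a * (?x - delete_gens R ?x) \<in> J"
      using Cons.prems by (intro J_closed(5)) auto
    moreover have "(free_gen a - delete_gens R (free_gen a)) * delete_gens R ?x \<in> J"
    proof (rule J_closed(6))
      show "free_gen a - delete_gens R (free_gen a) \<in> J"
        using Cons.prems R J_closed(2) by simp
      show "delete_gens R ?x \<in> carrier (free_algebra I)"
        using Cons.prems by (auto intro!: free_algebra_carrier_intros(4))
    qed
    \<comment> \<open>Telescoping: with \<open>D\<close> for deletion,
      \<open>a * x - D a * D x = a * (x - D x) + (a - D a) * D x\<close>.\<close>
    ultimately have "free_gen a * (?x - delete_gens R ?x) +
        (free_gen a - delete_gens R (free_gen a)) * delete_gens R ?x \<in> J"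
      by (rule J_closed)
    then show ?case
      unfolding single_Word_Cons delete_gens_simps(3) by (simp add: algebra_simps del: delete_gens_simps(4,6))
  qed (simp add: J_closed)
  show ?thesis
  proof (induction f rule: poly_mapping_single_induct)
    case zero
    then show ?case
      using J_closed by (simp add: delete_gens_def)
  next
    case (add f g)
    then show ?case
      using J_closed(3)[OF add] by (simp add: algebra_simps)
  next
    case (single w c)
    obtain v where v: "w = Word v" "set v \<subseteq> I"
      using single f by (cases w) (force simp: free_algebra_carrier)
    have "Poly_Mapping.single 0 c * (Poly_Mapping.single w 1 - delete_gens R (Poly_Mapping.single w 1)) \<in> J"
      using word[OF v(2)] unfolding v(1) by (intro J_closed(5)) auto
    then show ?case
      by (simp add: right_diff_distrib mult_single)
  qed
qed

section \<open>Quotients of free algebras\<close>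

text \<open>The first isomorphism theorem for \<open>\<phi>\<close> followed by the projection
  modulo \<open>J'\<close>. Scalars act as multiplication by constants, so fixing the constants
  makes the ring isomorphism linear.\<close>

lemma quotient_free_algebra_iso:
  fixes \<phi> :: "('a free_word \<Rightarrow>\<^sub>0 'k::field) \<Rightarrow> ('b free_word \<Rightarrow>\<^sub>0 'k)"
  assumes J: "ideal J (free_algebra I)" and J': "ideal J' (free_algebra I')"
    and hom: "\<phi> \<in> ring_hom (free_algebra I) (free_algebra I')"
    and const: "\<And>c. \<phi> (Poly_Mapping.single 0 c) = Poly_Mapping.single 0 c"
    and surj: "\<phi> ` carrier (free_algebra I) = carrier (free_algebra I')"
    and ker: "J = {f \<in> carrier (free_algebra I). \<phi> f \<in> J'}"
  shows "quotient_algebra (free_algebra I) J \<simeq>\<^sub>a quotient_algebra (free_algebra I') J'"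
proof -
  let ?F = "free_algebra I :: ('k, 'a free_word \<Rightarrow>\<^sub>0 'k) module"
  let ?F' = "free_algebra I' :: ('k, 'b free_word \<Rightarrow>\<^sub>0 'k) module"
  let ?h = "\<lambda>f. J' +>\<^bsub>?F'\<^esub> \<phi> f"
  let ?H = "\<lambda>X. the_elem (?h ` X)"
  have \<phi>: "\<phi> f \<in> carrier ?F'" if "f \<in> carrier ?F" for f
    using surj that by blast
  have "?h \<in> ring_hom ?F (?F' Quot J')"
    using ring_hom_trans[OF hom ideal.rcos_ring_hom[OF J']] by (simp add: comp_def)
  then have h: "ring_hom_ring ?F (?F' Quot J') ?h"
    by (intro ring_hom_ringI2 ring_free_algebra ideal.quotient_is_ring[OF J'])
  have coset_eq: "?h f = J' \<longleftrightarrow> \<phi> f \<in> J'" if "f \<in> carrier ?F" for f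
  proof -
    have "J' +>\<^bsub>?F'\<^esub> 0 = J'"
      using ideal.axioms(1)[OF J'] abelian_group.a_coset_add_zero[OF ring.is_abelian_group[OF ring_free_algebra], of J' I']
        free_algebra_ideal(1)[OF J'] by simp
    then show ?thesis
      using free_algebra_ideal_coset[OF J' \<phi>[OF that], of 0] by (auto simp: free_algebra_carrier)
  qed
  have kernel: "a_kernel ?F (?F' Quot J') ?h = J"
  proof -
    have "a_kernel ?F (?F' Quot J') ?h = {f \<in> carrier ?F. ?h f = J'}"
      by (simp add: a_kernel_def' FactRing_def)
    also have "\<dots> = J"
      unfolding ker using coset_eq by blast
    finally show ?thesis .
  qed
  have "carrier (?F' Quot J') = (\<lambda>f. J' +>\<^bsub>?F'\<^esub> f) ` carrier ?F'"
    unfolding FactRing_def A_RCOSETS_def' by auto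
  then have "?h ` carrier ?F = carrier (?F' Quot J')"
    unfolding surj[symmetric] image_image by simp
  from ring_hom_ring.FactRing_iso_set[OF h this] have iso: "?H \<in> ring_iso (?F Quot J) (?F' Quot J')"
    by (simp add: kernel)
  have H: "?H (J +>\<^bsub>?F\<^esub> f) = ?h f" if "f \<in> carrier ?F" for f
    using ring_hom_ring.the_elem_simp[OF h that] by (simp add: kernel)
  have "?H (c \<odot>\<^bsub>quotient_algebra ?F J\<^esub> X) = c \<odot>\<^bsub>quotient_algebra ?F' J'\<^esub> ?H X"
    if X: "X \<in> carrier (quotient_algebra ?F J)" for c X
  proof -
    obtain f where f: "f \<in> carrier ?F" and X: "X = J +>\<^bsub>?F\<^esub> f"
      using X by (auto simp: quotient_algebra_def ring.defs FactRing_def A_RCOSETS_def')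
    have cf: "Poly_Mapping.single 0 c * f \<in> carrier ?F"
      using f by auto
    have "\<phi> (Poly_Mapping.single 0 c * f) = Poly_Mapping.single 0 c * \<phi> f"
      using ring_hom_mult[OF hom free_algebra_carrier_intros(2)[of c] f] const by simp
    then show ?thesis
      unfolding X smult_quotient_algebra_free[OF J f] H[OF f]
        smult_quotient_algebra_free[OF J' \<phi>[OF f]]
      using H[OF cf] by simp
  qed
  \<comment> \<open>\<open>quotient_algebra\<close> only adds a scalar multiplication to the
    quotient ring, so the ring isomorphism carries over.\<close>
  with iso have "?H \<in> algebra_iso (quotient_algebra ?F J) (quotient_algebra ?F' J')"
    by (simp add: algebra_iso_def ring_iso_def ring_hom_def quotient_algebra_def ring.defs)
  then show ?thesis
    unfolding is_algebra_iso_def by blast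
qed

section \<open>Relations in Hecke algebras\<close>

abbreviation hecke_ideal ::
  "'a set \<Rightarrow> ('a \<Rightarrow> 'a \<Rightarrow> enat) \<Rightarrow> ('a \<Rightarrow> 'k::field) \<Rightarrow> ('a free_word \<Rightarrow>\<^sub>0 'k) set" where
  "hecke_ideal I m q \<equiv> Idl\<^bsub>free_algebra I\<^esub> (hecke_relators I m q)"

lemma ideal_hecke_ideal: "ideal (hecke_ideal I m q) (free_algebra I)"
  by (intro ring.genideal_ideal ring_free_algebra hecke_relators_subset)

lemmas hecke_ideal_closed = free_algebra_ideal[OF ideal_hecke_ideal]

lemma hecke_relators_in_ideal: "hecke_relators I m q \<subseteq> hecke_ideal I m q"
  by (intro ring.genideal_self ring_free_algebra hecke_relators_subset)

lemma hecke_ideal_quadratic: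
  "s \<in> I \<Longrightarrow> (free_gen s - 1) * (free_gen s + Poly_Mapping.single 0 (q s)) \<in> hecke_ideal I m q"
  by (rule subsetD[OF hecke_relators_in_ideal]) (auto simp: hecke_relators_def)

lemma hecke_ideal_braid:
  "\<lbrakk>s \<in> I; t \<in> I; s \<noteq> t; m s t = enat n\<rbrakk> \<Longrightarrow>
    Poly_Mapping.single (Word (alternating s t n)) 1 - Poly_Mapping.single (Word (alternating t s n)) 1
      \<in> hecke_ideal I m q"
  by (rule subsetD[OF hecke_relators_in_ideal])
    (unfold hecke_relators_def prod_list_free_gen, blast)

text \<open>The ideal for \<open>I\<close> need not lie in the smaller free algebra, but its
  intersection with that algebra is an ideal there and contains all relators for
  \<open>I'\<close>.\<close>

lemma hecke_ideal_mono:
  fixes q :: "'a \<Rightarrow> 'k::field"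
  assumes "I' \<subseteq> I"
  shows "hecke_ideal I' m q \<subseteq> hecke_ideal I m q"
proof -
  let ?F' = "free_algebra I' :: ('k, 'a free_word \<Rightarrow>\<^sub>0 'k) module"
  let ?J = "hecke_ideal I m q"
  have "subgroup (?J \<inter> carrier ?F') (add_monoid ?F')"
  proof (rule group.subgroupI)
    show "group (add_monoid ?F')"
      using ring.is_abelian_group[OF ring_free_algebra] by (rule abelian_group.a_group)
    show "?J \<inter> carrier ?F' \<noteq> {}"
      using hecke_ideal_closed(2)[of I m q] by (auto simp: free_algebra_carrier)
    show "inv\<^bsub>add_monoid ?F'\<^esub> x \<in> ?J \<inter> carrier ?F'" if "x \<in> ?J \<inter> carrier ?F'" for x
      using that hecke_ideal_closed(4)[OF hecke_ideal_closed(2), of x] free_algebra_minus[of x I']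
      by (auto simp: a_inv_def)
  qed (auto intro: hecke_ideal_closed)
  then have "ideal (?J \<inter> carrier ?F') ?F'"
    using free_algebra_mono[OF assms]
    by (intro idealI ring_free_algebra) (auto intro: hecke_ideal_closed)
  moreover have "hecke_relators I' m q \<subseteq> hecke_relators I m q"
    using assms unfolding hecke_relators_def by blast
  ultimately have "hecke_ideal I' m q \<subseteq> ?J \<inter> carrier ?F'"
    using hecke_relators_in_ideal[of I m q] hecke_relators_subset[of I' m q]
    by (intro ring.genideal_minimal ring_free_algebra) blast+
  then show ?thesis
    by blast
qed

text \<open>The inverse of \<open>T\<^sub>s\<close> is \<open>q\<^sub>s\<^sup>-\<^sup>1 (T\<^sub>s + q\<^sub>s - 1)\<close>.\<close>

lemma hecke_ideal_cancel:
  fixes q :: "'a \<Rightarrow> 'k::field"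
  assumes s: "s \<in> I" "q s \<noteq> 0" and x: "x \<in> carrier (free_algebra I)"
  shows "free_gen s * x \<in> hecke_ideal I m q \<Longrightarrow> x \<in> hecke_ideal I m q"
    and "x * free_gen s \<in> hecke_ideal I m q \<Longrightarrow> x \<in> hecke_ideal I m q"
proof -
  let ?T = "free_gen s :: 'a free_word \<Rightarrow>\<^sub>0 'k"
  let ?Q = "Poly_Mapping.single 0 (q s) :: 'a free_word \<Rightarrow>\<^sub>0 'k"
  let ?Q' = "Poly_Mapping.single 0 (inverse (q s)) :: 'a free_word \<Rightarrow>\<^sub>0 'k"
  note comm = single_0_commute[of "q s" ?T, symmetric] single_0_commute[of "q s" x, symmetric]
  have Q': "?Q' * (?Q * x) = x"
    using s by (simp add: mult_single flip: mult.assoc)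
  have C: "?T + ?Q - 1 \<in> carrier (free_algebra I)" "?Q' \<in> carrier (free_algebra I)"
    using s by auto
  have quad: "(?T - 1) * (?T + ?Q) \<in> hecke_ideal I m q"
    using s(1) by (rule hecke_ideal_quadratic)
  show "x \<in> hecke_ideal I m q" if "?T * x \<in> hecke_ideal I m q"
  proof -
    \<comment> \<open>This rests on \<open>(?T + ?Q - 1) * ?T = (?T - 1) * (?T + ?Q) + ?Q\<close>,
      whose first summand is a relator.\<close>
    have "?Q * x = (?T + ?Q - 1) * (?T * x) - (?T - 1) * (?T + ?Q) * x"
      by (simp add: algebra_simps comm)
    also have "\<dots> \<in> hecke_ideal I m q"
      by (intro hecke_ideal_closed that quad C x)
    finally show ?thesis
      using hecke_ideal_closed(5)[OF _ C(2)] Q' by metis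
  qed
  show "x \<in> hecke_ideal I m q" if "x * ?T \<in> hecke_ideal I m q"
  proof -
    have "?Q * x = (x * ?T) * (?T + ?Q - 1) - x * ((?T - 1) * (?T + ?Q))"
      by (simp add: algebra_simps comm)
    also have "\<dots> \<in> hecke_ideal I m q"
      by (intro hecke_ideal_closed that quad C x)
    finally show ?thesis
      using hecke_ideal_closed(5)[OF _ C(2)] Q' by metis
  qed
qed

lemma hecke_ideal_cancel_word:
  fixes q :: "'a \<Rightarrow> 'k::field"
  assumes "set v \<subseteq> I" "0 \<notin> q ` set v" "x \<in> carrier (free_algebra I)"
  shows "Poly_Mapping.single (Word v) 1 * x \<in> hecke_ideal I m q \<Longrightarrow> x \<in> hecke_ideal I m q"
    and "x * Poly_Mapping.single (Word v) 1 \<in> hecke_ideal I m q \<Longrightarrow> x \<in> hecke_ideal I m q"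
proof -
  show "x \<in> hecke_ideal I m q" if "Poly_Mapping.single (Word v) 1 * x \<in> hecke_ideal I m q"
    using assms that
  proof (induction v)
    case Nil
    then show ?case
      by (simp flip: zero_free_word_def)
  next
    case (Cons a v)
    have C: "Poly_Mapping.single (Word v) 1 * x \<in> carrier (free_algebra I)"
      using Cons.prems by (intro free_algebra_carrier_intros(4,5)) auto
    have "Poly_Mapping.single (Word v) 1 * x \<in> hecke_ideal I m q"
      by (rule hecke_ideal_cancel(1)[OF _ _ C, of a])
        (use Cons.prems in \<open>simp_all add: single_Word_Cons mult.assoc\<close>)
    then show ?case
      using Cons.IH Cons.prems by simp
  qed
  show "x \<in> hecke_ideal I m q" if "x * Poly_Mapping.single (Word v) 1 \<in> hecke_ideal I m q"
    using assms that
  \<comment> \<open>From the right, the first letter \<open>a\<close> of the word is adjacent to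
    \<open>x\<close>: the induction hypothesis is applied to \<open>x * free_gen a\<close>, and
    \<open>a\<close> is cancelled last.\<close>
  proof (induction v arbitrary: x)
    case Nil
    then show ?case
      by (simp flip: zero_free_word_def)
  next
    case (Cons a v)
    have "x * free_gen a \<in> carrier (free_algebra I)"
      using Cons.prems by (intro free_algebra_carrier_intros(3,5)) simp_all
    moreover have "x * free_gen a * Poly_Mapping.single (Word v) 1 \<in> hecke_ideal I m q"
      using Cons.prems(4) by (simp only: single_Word_Cons mult.assoc)
    ultimately have "x * free_gen a \<in> hecke_ideal I m q"
      using Cons.IH Cons.prems by simp
    then show ?case
      using hecke_ideal_cancel(2)[of a I q x m] Cons.prems by simp
  qed
qed

section \<open>Alternating words and the generators that odd braid relations make trivial\<close>

lemma set_alternating: "set (alternating a b n) \<subseteq> {a, b}"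
  by (induction n arbitrary: a b) auto

text \<open>The recursion exposes the first letter; the last one is needed to factor a braid word
  from the right.\<close>

lemma alternating_snoc:
  "alternating a b (Suc n) = alternating a b n @ [if even n then a else b]"
proof (induction n arbitrary: a b)
  case (Suc n)
  have "alternating a b (Suc (Suc n)) = a # alternating b a n @ [if even n then b else a]"
    by (simp only: alternating.simps(2)[of a b] Suc)
  also have "\<dots> = alternating a b (Suc n) @ [if even (Suc n) then a else b]"
    by simp
  finally show ?case .
qed simp

text \<open>Every second letter is \<open>b\<close>, and a word starting with \<open>b\<close>
  contains the half of \<open>n\<close> rounded up. The two exponents thus differ, by one, exactly
  for odd \<open>n\<close>.\<close>

lemma filter_alternating:
  assumes "P b" "\<not> P a"
  shows "filter P (alternating a b n) = replicate (n div 2) b"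
    and "filter P (alternating b a n) = replicate (Suc n div 2) b"
  using assms by (induction n) simp_all

text \<open>For odd \<open>n\<close> the braid relation reads \<open>Ts * y = y * Tt\<close> with
  \<open>y\<close> alternating of length \<open>n - 1\<close>, and \<open>y\<close> can be cancelled
  since \<open>q s\<close> and \<open>q t\<close> are nonzero. The quadratic relation of
  \<open>t\<close> thus passes to \<open>Ts\<close>; subtracting that of \<open>s\<close> leaves
  \<open>Ts - 1\<close> times the nonzero scalar \<open>q t - q s\<close>.\<close>

lemma hecke_gen_trivial:
  fixes q :: "'a \<Rightarrow> 'k::field"
  assumes st: "s \<in> I" "t \<in> I" "s \<noteq> t" "m s t = enat n" "odd n"
    and q: "q s \<noteq> 0" "q t \<noteq> 0" "q s \<noteq> q t"
  shows "free_gen s - 1 \<in> hecke_ideal I m q"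
proof -
  let ?J = "hecke_ideal I m q"
  let ?W = "\<lambda>v. Poly_Mapping.single (Word v) 1 :: 'a free_word \<Rightarrow>\<^sub>0 'k"
  let ?c = "\<lambda>r. Poly_Mapping.single 0 (q r) :: 'a free_word \<Rightarrow>\<^sub>0 'k"
  define Ts Tt y where "Ts = (free_gen s :: 'a free_word \<Rightarrow>\<^sub>0 'k)"
    and "Tt = (free_gen t :: 'a free_word \<Rightarrow>\<^sub>0 'k)" and "y = ?W (alternating t s (n - 1))"
  have set: "set (alternating t s (n - 1)) \<subseteq> {s, t}"
    using set_alternating[of t s] by blast
  then have y: "y \<in> carrier (free_algebra I)"
    unfolding y_def using st by (intro free_algebra_carrier_intros(4)) blast
  have T: "Ts \<in> carrier (free_algebra I)" "Tt \<in> carrier (free_algebra I)"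
    unfolding Ts_def Tt_def using st by auto
  obtain k where n: "n = Suc k" "even k"
    using \<open>odd n\<close> by (cases n) auto
  have "?W (alternating s t n) = Ts * y"
    unfolding Ts_def y_def n(1) by (simp add: single_Word_Cons)
  \<comment> \<open>As \<open>k = n - 1\<close> is even, the last letter is
    \<open>t\<close>.\<close>
  moreover have "?W (alternating t s n) = y * Tt"
    unfolding Tt_def y_def n(1) alternating_snoc using n(2) by (simp add: single_Word_snoc)
  ultimately have d: "Ts * y - y * Tt \<in> ?J"
    using hecke_ideal_braid[of s I t m n q] st by simp
  note comm = single_0_commute[of "q t" Ts, symmetric] single_0_commute[of "q t" Tt, symmetric]
    single_0_commute[of "q t" y, symmetric]
  \<comment> \<open>These variants move the scalar to the front inside longer products.\<close>
  have left_comm: "Ts * (?c t * z) = ?c t * (Ts * z)" "y * (?c t * z) = ?c t * (y * z)" for z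
    by (simp_all add: comm flip: mult.assoc)
  \<comment> \<open>Moving \<open>y\<close> past the polynomial \<open>(x - 1) * (x + q t)\<close>
    costs only multiples of \<open>Ts * y - y * Tt\<close>; the cofactors are explicit.\<close>
  have "(Ts - 1) * (Ts + ?c t) * y =
      y * ((Tt - 1) * (Tt + ?c t)) + (Ts + ?c t - 1) * (Ts * y - y * Tt) + (Ts * y - y * Tt) * Tt"
    by (simp add: algebra_simps comm left_comm)
  also have "\<dots> \<in> ?J"
  proof (intro hecke_ideal_closed(3))
    show "y * ((Tt - 1) * (Tt + ?c t)) \<in> ?J"
      using hecke_ideal_closed(5)[OF hecke_ideal_quadratic[OF st(2)] y] by (simp add: Tt_def)
    have "Ts + ?c t - 1 \<in> carrier (free_algebra I)"
      using T by auto
    then show "(Ts + ?c t - 1) * (Ts * y - y * Tt) \<in> ?J"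
      by (rule hecke_ideal_closed(5)[OF d])
    show "(Ts * y - y * Tt) * Tt \<in> ?J"
      by (rule hecke_ideal_closed(6)[OF d T(2)])
  qed
  finally have "(Ts - 1) * (Ts + ?c t) \<in> ?J"
    unfolding y_def by (rule hecke_ideal_cancel_word(2)[rotated -1]) (use set st q T in auto)
  then have "(Ts - 1) * (Ts + ?c t) - (Ts - 1) * (Ts + ?c s) \<in> ?J"
    using hecke_ideal_quadratic[OF st(1), of q m] by (intro hecke_ideal_closed(4)) (auto simp: Ts_def)
  also have "(Ts - 1) * (Ts + ?c t) - (Ts - 1) * (Ts + ?c s) =
      (Ts - 1) * Poly_Mapping.single 0 (q t - q s)"
    by (simp add: algebra_simps single_diff)
  finally have "(Ts - 1) * Poly_Mapping.single 0 (q t - q s) *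
      Poly_Mapping.single 0 (inverse (q t - q s)) \<in> ?J"
    by (rule hecke_ideal_closed(6)) auto
  then show ?thesis
    using q(3) by (simp add: mult.assoc mult_single Ts_def)
qed

text \<open>Deleting \<open>a\<close> changes nothing modulo the ideal and turns the braid
  difference into a difference of consecutive powers of \<open>free_gen b\<close>. The smaller power
  is cancelled because \<open>q b \<noteq> 0\<close>.\<close>

lemma hecke_gen_trivial_step:
  fixes q :: "'a \<Rightarrow> 'k::field"
  assumes ab: "a \<in> I" "b \<in> I" "a \<noteq> b" "m a b = enat n" "odd n" and "q b \<noteq> 0"
    and a: "free_gen a - 1 \<in> hecke_ideal I m q"
  shows "free_gen b - 1 \<in> hecke_ideal I m q"
proof -
  let ?J = "hecke_ideal I m q"
  let ?W = "\<lambda>v. Poly_Mapping.single (Word v) 1 :: 'a free_word \<Rightarrow>\<^sub>0 'k"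
  let ?d = "?W (alternating a b n) - ?W (alternating b a n)"
  have d: "?d \<in> ?J"
    using ab(1-4) by (rule hecke_ideal_braid)
  then have "?d - delete_gens {a} ?d \<in> ?J"
    using a hecke_ideal_closed(1)[of I m q]
    by (intro diff_delete_gens_in_ideal[OF ideal_hecke_ideal]) auto
  \<comment> \<open>The difference of the two memberships is the negated image, which matches the
    sign of \<open>free_gen b - 1\<close> below.\<close>
  from hecke_ideal_closed(4)[OF this d] have "- delete_gens {a} ?d \<in> ?J"
    by simp
  also have "- delete_gens {a} ?d = ?W (replicate (n div 2) b) * (free_gen b - 1)"
    using ab by (simp add: filter_alternating algebra_simps free_gen_def mult_single
        plus_free_word_def replicate_append_same)
  finally show ?thesis
    by (rule hecke_ideal_cancel_word(1)[rotated -1]) (use ab \<open>q b \<noteq> 0\<close> in auto)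
qed

lemma hecke_gen_trivial_path:
  fixes q :: "'a \<Rightarrow> 'k::field"
  assumes "p \<noteq> []" "successively (diagram_edge I m) p" "successively (\<lambda>a b. odd_weight (m a b)) p"
    and "\<forall>v\<in>set p. q v \<noteq> 0" "free_gen (hd p) - 1 \<in> hecke_ideal I m q"
  shows "free_gen (last p) - 1 \<in> hecke_ideal I m q"
  using assms
proof (induction p rule: induct_list012)
  case (3 a b p)
  then obtain n where n: "m a b = enat n" "odd n"
    by (auto simp: odd_weight_def)
  have "free_gen b - 1 \<in> hecke_ideal I m q"
    by (rule hecke_gen_trivial_step[where m = m, OF _ _ _ n])
      (use "3.prems" in \<open>simp_all add: diagram_edge_def\<close>)
  then show ?case
    using "3.IH"(2) "3.prems" by simp
qed simp_all

section \<open>The odd component of \<open>s\<close>\<close>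

lemma odd_nonzero_component_trivial:
  assumes "free_gen s - 1 \<in> hecke_ideal S m q" and "r \<in> odd_nonzero_component S m q s"
  shows "free_gen r - 1 \<in> hecke_ideal S m q"
proof -
  obtain p where "diagram_path S m s p r" "successively (\<lambda>a b. odd_weight (m a b)) p"
    "\<forall>v\<in>set p. q v \<noteq> 0"
    using assms(2) by (auto simp: odd_nonzero_component_def)
  then show ?thesis
    using assms(1) hecke_gen_trivial_path[of p S m q] by (simp add: diagram_path_def)
qed

text \<open>Maximality of the component, used in contrapositive form: an edge of odd weight that
  leaves it ends at a vertex with parameter 0.\<close>

lemma odd_nonzero_component_step:
  assumes r: "r \<in> odd_nonzero_component S m q s"
    and u: "diagram_edge S m r u" "odd_weight (m r u)" "q u \<noteq> 0"
  shows "u \<in> odd_nonzero_component S m q s"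
proof -
  obtain p where p: "diagram_path S m s p r" "successively (\<lambda>a b. odd_weight (m a b)) p"
    "\<forall>v\<in>set p. q v \<noteq> 0"
    using r by (auto simp: odd_nonzero_component_def)
  have "\<exists>p'. diagram_path S m s p' u \<and> successively (\<lambda>a b. odd_weight (m a b)) p' \<and>
      (\<forall>v\<in>set p'. q v \<noteq> 0)"
  proof (cases "u \<in> set p")
    case True
    then obtain xs ys where "p = xs @ u # ys"
      by (auto dest: split_list)
    \<comment> \<open>Paths have distinct vertices, so a path already through \<open>u\<close> is
      cut off at \<open>u\<close> instead of extended.\<close>
    then show ?thesis
      using p
      by (intro exI[of _ "xs @ [u]"])
        (auto simp: diagram_path_def successively_append_iff hd_append split: if_splits)
  next
    case False
    then show ?thesis
      using p u
      by (intro exI[of _ "p @ [u]"])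
        (auto simp: diagram_path_def successively_append_iff diagram_edge_def)
  qed
  then show ?thesis
    using u(1) by (auto simp: odd_nonzero_component_def diagram_edge_def)
qed

section \<open>Relators under deletion, and the isomorphism\<close>

text \<open>For even \<open>n\<close> both sides become the same power of \<open>free_gen b\<close>.
  For odd \<open>n\<close> the powers are consecutive and positive, and their difference is a
  multiple of \<open>(free_gen b - 1) * free_gen b\<close>, the quadratic relator at
  \<open>q b = 0\<close>.\<close>

lemma delete_gens_braid:
  fixes q :: "'a \<Rightarrow> 'k::field"
  assumes a: "a \<in> R" and b: "b \<in> I" "b \<notin> R" and n: "n \<ge> 2" "odd n \<Longrightarrow> q b = 0"
  shows "delete_gens R (Poly_Mapping.single (Word (alternating a b n)) 1 -
    Poly_Mapping.single (Word (alternating b a n)) 1) \<in> hecke_ideal (I - R) m q"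
proof (cases "even n")
  case True
  then have "Suc n div 2 = n div 2"
    by presburger
  then show ?thesis
    using a b hecke_ideal_closed(2)[of "I - R" m q] by (simp add: filter_alternating)
next
  case False
  let ?W = "\<lambda>v. Poly_Mapping.single (Word v) 1 :: 'a free_word \<Rightarrow>\<^sub>0 'k"
  \<comment> \<open>An odd \<open>n \<ge> 2\<close> is at least 3, so the smaller exponent is
    positive and supplies the factor \<open>free_gen b\<close> of the relator.\<close>
  have "n div 2 \<noteq> 0" "Suc n div 2 = Suc (n div 2)"
    using n(1) False by presburger+
  then obtain k where k: "n div 2 = Suc k" "Suc n div 2 = Suc (Suc k)"
    by (metis not0_implies_Suc)
  have quad: "(free_gen b - 1) * (free_gen b + Poly_Mapping.single 0 (q b)) \<in> hecke_ideal (I - R) m q"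
    using b by (intro hecke_ideal_quadratic) auto
  have "(free_gen b - 1) * (free_gen b + Poly_Mapping.single 0 (q b)) * - ?W (replicate k b)
      \<in> hecke_ideal (I - R) m q"
    using b by (intro hecke_ideal_closed(6)[OF quad]) (auto intro!: free_algebra_carrier_intros(8,4))
  then show ?thesis
    using a b n(2) False
    by (simp add: filter_alternating k algebra_simps free_gen_def mult_single plus_free_word_def)
qed

theorem theorem1p3:
  fixes W :: "('w, 'b) monoid_scheme" and S :: "'w set" and m :: "'w \<Rightarrow> 'w \<Rightarrow> enat"
    and q :: "'w \<Rightarrow> 'k::field" and s t :: 'w
  assumes "coxeter_system W S m"
    and "s \<in> S" and "t \<in> S" and "odd_weight (m s t)"
    and "q s \<noteq> q t" and "q s \<noteq> 0" and "q t \<noteq> 0"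
  shows "hecke_algebra S m q \<simeq>\<^sub>a hecke_algebra (S - odd_nonzero_component S m q s) m q"
proof -
  interpret coxeter_system W S m
    by fact
  define R where "R = odd_nonzero_component S m q s"
  let ?F = "free_algebra S :: ('k, 'w free_word \<Rightarrow>\<^sub>0 'k) module"
  let ?F' = "free_algebra (S - R) :: ('k, 'w free_word \<Rightarrow>\<^sub>0 'k) module"
  let ?J = "hecke_ideal S m q" and ?J' = "hecke_ideal (S - R) m q"
  \<comment> \<open>The preimage of \<open>?J'\<close> under deletion; \<open>?J = ?K\<close> is the
    kernel condition of \<open>quotient_free_algebra_iso\<close>.\<close>
  let ?K = "{f \<in> carrier ?F. delete_gens R f \<in> ?J'}"
  \<comment> \<open>That \<open>s\<close> and \<open>t\<close> are different generators follows from
    \<open>q s \<noteq> q t\<close>.\<close>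
  have "free_gen s - 1 \<in> ?J"
    using assms(2-) by (auto simp: odd_weight_def intro: hecke_gen_trivial)
  then have R: "free_gen r - 1 \<in> ?J" if "r \<in> R" for r
    using that unfolding R_def by (rule odd_nonzero_component_trivial)
  have braid: "delete_gens R (Poly_Mapping.single (Word (alternating a b n)) 1 -
      Poly_Mapping.single (Word (alternating b a n)) 1) \<in> ?J'"
    if "a \<in> S" "b \<in> S" "a \<noteq> b" "m a b = enat n" "a \<in> R" "b \<notin> R" for a b n
  proof (rule delete_gens_braid)
    show n: "n \<ge> 2"
      using m_ge_2[OF that(1-3)] that(4) by (simp add: numeral_eq_enat)
    show "q b = 0" if "odd n"
    proof (rule ccontr)
      assume "q b \<noteq> 0"
      \<comment> \<open>Diagram edges have weight at least 3; oddness excludes the value 2.\<close>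
      have "n \<ge> 3"
        using n \<open>odd n\<close> by (cases "n = 2") auto
      then have "diagram_edge S m a b"
        using \<open>a \<in> S\<close> \<open>b \<in> S\<close> \<open>a \<noteq> b\<close> \<open>m a b = enat n\<close>
        by (simp add: diagram_edge_def numeral_eq_enat)
      then show False
        using odd_nonzero_component_step[of a S m q s b] \<open>q b \<noteq> 0\<close> \<open>odd n\<close> \<open>m a b = enat n\<close>
          \<open>a \<in> R\<close> \<open>b \<notin> R\<close>
        by (simp add: R_def odd_weight_def)
    qed
  qed (use that in auto)
  have relators: "delete_gens R f \<in> ?J'" if rel: "f \<in> hecke_relators S m q" for f
  proof -
    consider a where "a \<in> S" "f = (free_gen a - 1) * (free_gen a + Poly_Mapping.single 0 (q a))"
      | a b n where "a \<in> S" "b \<in> S" "a \<noteq> b" "m a b = enat n"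
        "f = Poly_Mapping.single (Word (alternating a b n)) 1 -
          Poly_Mapping.single (Word (alternating b a n)) 1"
      using rel unfolding hecke_relators_def prod_list_free_gen by blast
    then show ?thesis
    proof cases
      case (1 a)
      then show ?thesis
        \<comment> \<open>For \<open>a \<in> R\<close> the factor \<open>free_gen a - 1\<close>
          becomes 0; otherwise the relator is fixed and is one for \<open>S - R\<close>.\<close>
        using hecke_ideal_quadratic[of a "S - R" q m] hecke_ideal_closed(2)[of "S - R" m q]
        by (cases "a \<in> R") (simp_all del: delete_gens_simps(4))
    next
      case (2 a b n)
      note ab = 2(1-4) and f = 2(5)
      consider "a \<in> R" "b \<in> R" | "a \<notin> R" "b \<notin> R" | "a \<in> R" "b \<notin> R" | "a \<notin> R" "b \<in> R"
        by blast
      then show ?thesis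
      proof cases
        case 1
        then have "filter (\<lambda>x. x \<notin> R) (alternating a b n) = []"
          "filter (\<lambda>x. x \<notin> R) (alternating b a n) = []"
          using set_alternating[of a b n] set_alternating[of b a n] by (auto simp: filter_empty_conv)
        then show ?thesis
          by (simp add: f hecke_ideal_closed(2))
      next
        case 2
        then have "f \<in> ?J'"
          unfolding f using ab by (intro hecke_ideal_braid) auto
        then show ?thesis
          using delete_gens_id[OF subsetD[OF hecke_ideal_closed(1)]] by metis
      next
        case 3
        then show ?thesis
          unfolding f using ab by (intro braid)
      next
        case 4
        have "m b a = enat n"
          using m_sym[OF ab(1-3)] ab(4) by simp
        \<comment> \<open>The previous case with \<open>a\<close> and \<open>b\<close> exchanged, by
          symmetry of \<open>m\<close>; the relator changes sign.\<close>
        then have "0 - delete_gens R (Poly_Mapping.single (Word (alternating b a n)) 1 -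
            Poly_Mapping.single (Word (alternating a b n)) 1) \<in> ?J'"
          using 4 ab by (intro hecke_ideal_closed(2,4) braid) auto
        then show ?thesis
          by (simp add: f)
      qed
    qed
  qed
  have hom: "delete_gens R \<in> ring_hom ?F ?F'"
    by (rule ring_hom_memI) (auto intro: delete_gens_carrier)
  have surj: "delete_gens R ` carrier ?F = carrier ?F'"
  proof
    show "carrier ?F' \<subseteq> delete_gens R ` carrier ?F"
      using free_algebra_mono[of "S - R" S] delete_gens_id[of _ S R] by (force simp: image_iff)
  qed (auto intro: delete_gens_carrier)
  have "?J \<subseteq> ?K"
  proof (rule ring.genideal_minimal[OF ring_free_algebra])
    interpret ring_hom_ring ?F ?F' "delete_gens R"
      using hom by (intro ring_hom_ringI2 ring_free_algebra)
    show "ideal ?K ?F"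
      using ideal_vimage[OF ideal_hecke_ideal] by simp
    show "hecke_relators S m q \<subseteq> ?K"
      using relators hecke_relators_subset[of S m q] by blast
  qed
  moreover have "?K \<subseteq> ?J"
  proof
    fix f
    assume f: "f \<in> ?K"
    \<comment> \<open>Split \<open>f\<close> into \<open>f - delete_gens R f\<close>, controlled by
      the trivial generators, and \<open>delete_gens R f\<close>, which lies in \<open>?J'\<close>
      and hence in \<open>?J\<close>.\<close>
    then have "f - delete_gens R f \<in> ?J"
      using R by (intro diff_delete_gens_in_ideal[OF ideal_hecke_ideal]) auto
    moreover have "delete_gens R f \<in> ?J"
      using f hecke_ideal_mono[of "S - R" S m q] by blast
    ultimately have "f - delete_gens R f + delete_gens R f \<in> ?J"
      by (rule hecke_ideal_closed)
    then show "f \<in> ?J"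
      by simp
  qed
  ultimately show ?thesis
    unfolding hecke_algebra_def R_def[symmetric]
    by (intro quotient_free_algebra_iso[OF ideal_hecke_ideal ideal_hecke_ideal hom delete_gens_const surj]) auto
qed

end
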